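(* Let $b\ge 2$ be an integer which is not a proper power. Let $g:\mathbb{N}\to\mathbb{R}$ be a continuous non-decreasing function such that $\frac{g(n+1)}{g(n)}\to 1$ as $n\to\infty$. Let $f:\mathbb{N}\to\mathbb{N}$ be a non-decreasing function such that $\frac{f(n+1)}{f(n)}\sim g(n)$ as $n\to\infty$, and denote by $\alpha$ the real number whose base-$b$ expansion is $0.f(1)f(2)f(3)\ldots$, i.e. the digits of $\alpha$ after the point are obtained by concatenating the base-$b$ representations of $f(1),f(2),f(3),\ldots$ in this order. Suppose that $\alpha$ is rational. Then $g(n)$ converges to some constant $c$ as $n\to\infty$, $c$ is a power of $b$, and $f(n+1)=c f(n)+\mathcal{O}(1)$.
   Context: $\mathbb{N}$ denotes the set of positive integers (with its discrete topology, so continuity of $g$ is no restriction). An integer $b$ is a proper power if $b=a^m$ for integers $a$ and $m\ge2$. "Power of $b$" means $b^k$ for some integer $k\ge 0$. The notation $u(n)\sim v(n)$ means $u(n)/v(n)\to1$ as $n\to\infty$. The statement $f(n+1)=cf(n)+\mathcal{O}(1)$ means that $f(n+1)-cf(n)$ is bounded as a function of $n$. *)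

theory Defs
  imports
    Complex_Main
    "HOL-Library.Stream"
    "HOL-Library.Landau_Symbols"
    "HOL-Computational_Algebra.Nth_Powers"
begin

definition proper_power :: "int \<Rightarrow> bool" where
  "proper_power b \<longleftrightarrow> (\<exists>m\<ge>2. is_nth_power m b)"

text \<open>Digits of a number in base \<open>b\<close>, most significant digit first; the degenerate
  bases \<open>b < 2\<close> are cut off only to make the recursion terminate.\<close>

function base_repr :: "nat \<Rightarrow> nat \<Rightarrow> nat list" where
  "base_repr b n = (if b < 2 \<or> n < b then [n] else base_repr b (n div b) @ [n mod b])"
  by auto
termination by (relation "measure snd") auto

declare base_repr.simps [simp del]

lemma base_repr_neq_Nil [simp]: "base_repr b n \<noteq> []"
  by (subst base_repr.simps) simp

lemma base_repr_digit_less: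
  assumes "b \<ge> 2" "d \<in> set (base_repr b n)"
  shows "d < b"
  using assms
  by (induction b n rule: base_repr.induct) (subst (asm) (2) base_repr.simps, auto split: if_splits)

lemma horner_sum_base_repr: "horner_sum (\<lambda>d. d) b (rev (base_repr b n)) = n"
  by (induction b n rule: base_repr.induct) (subst base_repr.simps, simp)

lemma hd_base_repr_pos: "n > 0 \<Longrightarrow> hd (base_repr b n) > 0"
proof (induction b n rule: base_repr.induct)
  case (1 b n)
  then show ?case
    by (subst base_repr.simps) (auto simp: div_greater_zero_iff)
qed

text \<open>The digits \<open>f(1) f(2) f(3) \<dots>\<close> after the point; \<^const>\<open>flat\<close> is the infinite
  concatenation, which is meaningful since no \<^const>\<open>base_repr\<close> is empty.\<close>

definition concat_digits :: "nat \<Rightarrow> (nat \<Rightarrow> nat) \<Rightarrow> nat stream" where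
  "concat_digits b f = flat (smap (\<lambda>n. base_repr b (f n)) (fromN 1))"

definition concat_real :: "nat \<Rightarrow> (nat \<Rightarrow> nat) \<Rightarrow> real" where
  "concat_real b f = (\<Sum>k. real (concat_digits b f !! k) / real b ^ Suc k)"

end

theory Submission
  imports Defs
begin

text \<open>
  Let \<open>Y n\<close> be the real number \<open>0.f(n+1)f(n+2)\<dots>\<close> in base \<open>b\<close>. If \<open>f(n+1)\<close> has \<open>l n\<close> digits, then
  \<open>u n := b ^ l n * Y n = f(n+1) + Y (n+1)\<close>, and if \<open>Q * Y 0\<close> is an integer, then so is every
  \<open>Q * Y n\<close>. As \<open>1/b \<le> Y n \<le> 1\<close>, the sequence \<open>Y\<close> takes only finitely many values. If \<open>f\<close> is bounded,
  it is eventually constant. Otherwise \<open>f(n+1)\<close> is asymptotic to \<open>u n\<close>, so that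
  \<open>u n * u (n+2) / u (n+1)\<^sup>2\<close> tends to \<open>1\<close>. This quantity or its inverse is a fraction of
  denominator at most \<open>Q\<^sup>2\<close>, so it eventually equals \<open>1\<close>, i.e. \<open>u\<close> is eventually geometric with
  some ratio \<open>c\<close>. Comparing two indices at which \<open>Y\<close> takes the same value gives \<open>c ^ s = b ^ t\<close>
  with \<open>s > 0\<close>, and since \<open>c\<close> is rational and \<open>b\<close> is not a proper power, \<open>c\<close> is a power of \<open>b\<close>.
\<close>

section \<open>Expansions in base b\<close>

definition stream_val :: "nat \<Rightarrow> nat stream \<Rightarrow> real" where
  "stream_val b s = (\<Sum>k. real (s !! k) / real b ^ Suc k)"

lemma concat_real_eq_stream_val: "concat_real b f = stream_val b (concat_digits b f)"
  by (simp add: concat_real_def stream_val_def)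

text \<open>Geometric series for the expansion with all digits \<open>b - 1\<close>; it majorizes
  every digit series and so gives both convergence and the bound 1.\<close>

lemma digit_bound_sums:
  assumes "b \<ge> 2"
  shows "(\<lambda>k. (real b - 1) / real b ^ Suc k) sums 1"
proof -
  have "(\<lambda>k. (real b - 1) / real b * (1 / real b) ^ k) sums
      ((real b - 1) / real b * (1 / (1 - 1 / real b)))"
    using assms by (intro sums_mult geometric_sums) auto
  also have "(real b - 1) / real b * (1 / (1 - 1 / real b)) = 1"
    using assms by (simp add: field_simps)
  finally show ?thesis
    by (simp add: power_divide)
qed

context
  fixes b :: nat and s :: "nat stream"
  assumes base: "b \<ge> 2" and digits: "\<And>d. d \<in> sset s \<Longrightarrow> d < b"
begin

lemma digit_term_le: "real (s !! k) / real b ^ Suc k \<le> (real b - 1) / real b ^ Suc k"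
proof -
  have "s !! k < b"
    by (rule digits) simp
  then have "real (s !! k) \<le> real b - 1"
    by linarith
  then show ?thesis
    by (intro divide_right_mono) auto
qed

lemma summable_digits: "summable (\<lambda>k. real (s !! k) / real b ^ Suc k)"
proof (rule summable_comparison_test')
  show "summable (\<lambda>k. (real b - 1) / real b ^ Suc k)"
    using digit_bound_sums[OF base] by (rule sums_summable)
  show "norm (real (s !! k) / real b ^ Suc k) \<le> (real b - 1) / real b ^ Suc k" if "k \<ge> 0" for k
    using digit_term_le[of k] by (simp del: power_Suc)
qed

lemma stream_val_nonneg: "stream_val b s \<ge> 0"
  unfolding stream_val_def by (intro suminf_nonneg summable_digits) auto

lemma stream_val_le_1: "stream_val b s \<le> 1"
proof -
  have "stream_val b s \<le> (\<Sum>k. (real b - 1) / real b ^ Suc k)"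
    unfolding stream_val_def
    using sums_summable[OF digit_bound_sums[OF base]]
    by (intro suminf_le summable_digits) (auto intro: digit_term_le simp del: power_Suc)
  also have "\<dots> = 1"
    using digit_bound_sums[OF base] by (rule sums_unique[symmetric])
  finally show ?thesis .
qed

end

lemma stream_val_Cons:
  assumes "b \<ge> 2" "x < b" "\<And>d. d \<in> sset s \<Longrightarrow> d < b"
  shows "real b * stream_val b (x ## s) = real x + stream_val b s"
proof -
  have sum: "summable (\<lambda>k. real (s !! k) / real b ^ Suc k)"
    using assms by (intro summable_digits) auto
  have "summable (\<lambda>k. real ((x ## s) !! k) / real b ^ Suc k)"
    using assms by (intro summable_digits) auto
  from suminf_split_head[OF this] have "stream_val b (x ## s) =
      (\<Sum>k. real (s !! k) / real b ^ Suc (Suc k)) + real x / real b"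
    by (simp add: stream_val_def)
  also have "(\<Sum>k. real (s !! k) / real b ^ Suc (Suc k)) =
      (\<Sum>k. (1 / real b) * (real (s !! k) / real b ^ Suc k))"
    by (simp add: field_simps)
  also have "\<dots> = (1 / real b) * stream_val b s"
    unfolding stream_val_def by (rule suminf_mult[OF sum])
  finally show ?thesis
    using assms(1) by (simp add: field_simps)
qed

text \<open>Each factor \<open>b\<close> moves the point past one digit of \<open>xs\<close>. The
  list is reversed because \<open>horner_sum\<close> reads the least significant digit
  first.\<close>

lemma stream_val_shift:
  assumes "b \<ge> 2" "\<And>d. d \<in> set xs \<Longrightarrow> d < b" "\<And>d. d \<in> sset s \<Longrightarrow> d < b"
  shows "real b ^ length xs * stream_val b (xs @- s) =
    real (horner_sum (\<lambda>d. d) b (rev xs)) + stream_val b s"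
  using assms(2)
proof (induction xs)
  case (Cons x xs)
  have "real b * stream_val b (x ## (xs @- s)) = real x + stream_val b (xs @- s)"
    using Cons.prems assms by (intro stream_val_Cons) auto
  then have "real b ^ length xs * (real b * stream_val b (x ## (xs @- s))) =
      real b ^ length xs * real x + real b ^ length xs * stream_val b (xs @- s)"
    by (simp add: distrib_left)
  with Cons show ?case
    by (simp add: horner_sum_append mult_ac)
qed simp

section \<open>Splitting off the first block of the concatenation\<close>

lemma concat_digits_less:
  assumes "b \<ge> 2" "d \<in> sset (concat_digits b f)"
  shows "d < b"
  using assms(2) base_repr_digit_less[OF assms(1)]
  by (auto simp: concat_digits_def stream.set_map)

lemma concat_digits_unfold:
  "concat_digits b f = base_repr b (f 1) @- concat_digits b (\<lambda>m. f (Suc m))"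
proof -
  have "fromN 2 = smap Suc (fromN 1)"
    by (simp add: smap_siterate numeral_2_eq_2)
  then have "smap (\<lambda>n. base_repr b (f n)) (fromN 2) = smap (\<lambda>n. base_repr b (f (Suc n))) (fromN 1)"
    by (simp only: stream.map_comp o_def)
  then show ?thesis
    unfolding concat_digits_def
    by (subst flat_unfold) (simp_all add: numeral_2_eq_2)
qed

lemma concat_real_bounds:
  assumes "b \<ge> 2"
  shows "concat_real b f \<ge> 0" "concat_real b f \<le> 1"
  unfolding concat_real_eq_stream_val
  using assms concat_digits_less[OF assms] by (blast intro: stream_val_nonneg stream_val_le_1)+

text \<open>The tail is again a \<open>concat_real\<close>, of the shifted function, so this step
  can be iterated to give the recursion for \<open>Y\<close>.\<close>

lemma concat_real_unfold:
  assumes "b \<ge> 2"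
  shows "real b ^ length (base_repr b (f 1)) * concat_real b f =
    real (f 1) + concat_real b (\<lambda>m. f (Suc m))"
  unfolding concat_real_eq_stream_val
  by (subst concat_digits_unfold, subst stream_val_shift)
    (use assms base_repr_digit_less concat_digits_less in \<open>auto simp: horner_sum_base_repr\<close>)

lemma power_length_base_repr_le:
  assumes "b \<ge> 2" "n \<ge> 1"
  shows "b ^ length (base_repr b n) \<le> b * n"
  using assms
proof (induction b n rule: base_repr.induct)
  case (1 b n)
  show ?case
  proof (cases "n < b")
    case True
    then show ?thesis
      using 1 by (simp add: base_repr.simps[of b n])
  next
    case False
    then have "b ^ length (base_repr b (n div b)) \<le> b * (n div b)"
      using 1 by (intro "1.IH") (auto simp: div_greater_zero_iff Suc_le_eq)
    also have "\<dots> \<le> n"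
      by simp
    finally show ?thesis
      using 1 False by (subst base_repr.simps) auto
  qed
qed

section \<open>Arithmetic of the ratio\<close>

text \<open>Dividing the exponents by their gcd gives \<open>c ^ s' = b ^ t'\<close> with
  \<open>s'\<close> and \<open>t'\<close> coprime. Then \<open>s'\<close> divides the multiplicity
  of every prime in \<open>b\<close>, so \<open>b\<close> is an \<open>s'\<close>-th power, which
  forces \<open>s' = 1\<close>.\<close>

lemma power_eq_power_not_proper_power:
  fixes b c s t :: nat
  assumes "c ^ s = b ^ t" "s > 0" "b \<ge> 2" "\<not> proper_power (int b)"
  obtains k where "c = b ^ k"
proof (cases "t = 0")
  case True
  then show ?thesis
    using assms that[of 0] by simp
next
  case False
  define d where "d = gcd s t"
  have "d > 0"
    using assms by (simp add: d_def)
  obtain s' t' where st: "s = s' * d" "t = t' * d" "coprime s' t'"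
    using \<open>d > 0\<close> gcd_coprime_exists[of s t] unfolding d_def by blast
  have "s' > 0"
    using st assms by (cases s') auto
  have "(c ^ s') ^ d = (b ^ t') ^ d"
    using assms st by (simp add: power_mult)
  then have eq: "c ^ s' = b ^ t'"
    using \<open>d > 0\<close> by (simp add: power_eq_iff_eq_base)
  then have "is_nth_power s' (b ^ t')"
    by (metis is_nth_power_nth_power)
  then have "s' dvd t' * multiplicity p b" if "prime p" for p
    using that \<open>s' > 0\<close> assms
    by (simp add: is_nth_power_conv_multiplicity_nat prime_elem_multiplicity_power_distrib)
  then have "is_nth_power s' b"
    using st \<open>s' > 0\<close> by (simp add: is_nth_power_conv_multiplicity_nat coprime_dvd_mult_right_iff)
  then obtain a where "b = a ^ s'"
    by (rule is_nth_powerE)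
  then have "is_nth_power s' (int b)"
    by (auto simp: is_nth_power_def)
  then have "\<not> s' \<ge> 2"
    using assms by (auto simp: proper_power_def)
  then have "s' = 1"
    using \<open>s' > 0\<close> by linarith
  then show ?thesis
    using eq that by simp
qed

text \<open>A fraction with denominator \<open>B\<close> that differs from 1 is at distance at least
  \<open>1 / B\<close>, hence at least \<open>1 / K\<close>, from it.\<close>

lemma fraction_eq_1:
  fixes N B K :: nat
  assumes "\<bar>real N / real B - 1\<bar> < 1 / real K" "0 < B" "B \<le> K"
  shows "real N / real B = 1"
proof (rule ccontr)
  assume "real N / real B \<noteq> 1"
  then have "N \<noteq> B"
    using assms by auto
  then have "\<bar>real N - real B\<bar> \<ge> 1"
    by linarith
  moreover have "real N / real B - 1 = (real N - real B) / real B"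
    using assms by (simp add: field_simps)
  ultimately have "\<bar>real N / real B - 1\<bar> \<ge> 1 / real B"
    using assms by (simp add: divide_right_mono abs_divide)
  moreover have "1 / real B \<ge> 1 / real K"
    using assms by (simp add: frac_le)
  ultimately show False
    using assms(1) by linarith
qed

text \<open>Both \<open>p\<close> and its inverse tend to 1, so the gap of
  \<open>fraction_eq_1\<close> applies to whichever of them has the small denominator; the choice
  may depend on \<open>n\<close>.\<close>

lemma eventually_eq_1_of_bounded_denominator:
  fixes p :: "nat \<Rightarrow> real" and K :: nat
  assumes lim: "p \<longlonglongrightarrow> 1"
    and frac: "\<And>n. \<exists>N B::nat. 0 < B \<and> B \<le> K \<and> (p n = real N / real B \<or> inverse (p n) = real N / real B)"
  shows "\<forall>\<^sub>F n in sequentially. p n = 1"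
proof -
  have "K > 0"
    using frac[of 0] by auto
  have "(\<lambda>n. inverse (p n)) \<longlonglongrightarrow> 1"
    using tendsto_inverse[OF lim] by simp
  then have "\<forall>\<^sub>F n in sequentially. dist (inverse (p n)) 1 < 1 / real K"
    using \<open>K > 0\<close> by (intro tendstoD) auto
  moreover have "\<forall>\<^sub>F n in sequentially. dist (p n) 1 < 1 / real K"
    using \<open>K > 0\<close> by (intro tendstoD lim) auto
  ultimately show ?thesis
  proof eventually_elim
    case (elim n)
    obtain N B :: nat where NB: "0 < B" "B \<le> K"
        "p n = real N / real B \<or> inverse (p n) = real N / real B"
      using frac by blast
    with elim fraction_eq_1[of N B K] have "p n = 1 \<or> inverse (p n) = 1"
      by (auto simp: dist_real_def)
    then show ?case
      by auto
  qed
qed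

section \<open>Growth of the blocks\<close>

text \<open>Core of the unbounded case, with \<open>F n\<close> in the role of
  \<open>f (n + 1)\<close>. The digits enter only through \<open>rec\<close>, so \<open>l\<close>
  may be any sequence of exponents.\<close>

lemma eventually_geometric:
  fixes F l :: "nat \<Rightarrow> nat" and Y :: "nat \<Rightarrow> real" and b Q :: nat
  assumes b: "b \<ge> 2" "\<not> proper_power (int b)"
    and rec: "\<And>n. real b ^ l n * Y n = real (F n) + Y (Suc n)"
    and Y: "\<And>n. Y n > 0" "\<And>n. Y n \<le> 1"
    and Q: "Q > 0" "\<And>n. real Q * Y n \<in> \<int>"
    and F: "filterlim F at_top at_top"
    and ratio: "(\<lambda>n. real (F n) * real (F (Suc (Suc n))) / real (F (Suc n)) ^ 2) \<longlonglongrightarrow> 1"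
  obtains k where "\<forall>\<^sub>F n in sequentially.
    real b ^ l (Suc n) * Y (Suc n) = real b ^ k * (real b ^ l n * Y n)"
proof -
  define u where "u n = real b ^ l n * Y n" for n
  have u_pos: "u n > 0" for n
    using b Y by (simp add: u_def)
  have u_eq: "u n = real (F n) + Y (Suc n)" for n
    by (simp add: u_def rec)
  have u_ge: "u n \<ge> real (F n)" for n
    using Y[of "Suc n"] by (simp add: u_eq)

  \<comment> \<open>\<open>A n\<close> is the numerator of \<open>Y n\<close> over the common
    denominator \<open>Q\<close>, an integer between 1 and \<open>Q\<close>.\<close>
  define A where "A n = nat \<lfloor>real Q * Y n\<rfloor>" for n
  have A: "real (A n) = real Q * Y n" for n
    using Q(2)[of n] Q(1) Y(1)[of n] by (auto simp: A_def elim!: Ints_cases)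
  have A_pos: "A n > 0" for n
    using A[of n] Q(1) Y(1)[of n] by (metis gr0I mult_pos_pos of_nat_0 of_nat_0_less_iff less_irrefl)
  have A_le: "A n \<le> Q" for n
    using A[of n] Y[of n] by (metis mult_left_le of_nat_0_le_iff of_nat_le_iff)
  have Y_eq: "Y n = real (A n) / real Q" for n
    using A Q by simp

  have F_real: "filterlim (\<lambda>n. real (F n)) at_top at_top"
    by (rule filterlim_compose[OF filterlim_real_sequentially F])
  have u_F: "(\<lambda>n. u n / real (F n)) \<longlonglongrightarrow> 1"
  proof -
    have "(\<lambda>n. Y (Suc n) / real (F n)) \<longlonglongrightarrow> 0"
    proof (rule tendsto_0_le[OF tendsto_inverse_0_at_top[OF F_real], where K = 1])
      show "\<forall>\<^sub>F n in sequentially. norm (Y (Suc n) / real (F n)) \<le> norm (inverse (real (F n))) * 1"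
        using Y by (auto intro!: always_eventually simp: field_simps divide_right_mono abs_of_pos)
    qed
    then have "(\<lambda>n. 1 + Y (Suc n) / real (F n)) \<longlonglongrightarrow> 1 + 0"
      by (intro tendsto_intros)
    moreover have "\<forall>\<^sub>F n in sequentially. 1 + Y (Suc n) / real (F n) = u n / real (F n)"
      using filterlim_at_top_dense[THEN iffD1, OF F_real, rule_format, of 0]
      by eventually_elim (simp add: u_eq field_simps)
    ultimately show ?thesis
      by (simp add: tendsto_cong)
  qed

  define p where "p n = u n * u (Suc (Suc n)) / u (Suc n) ^ 2" for n
  have "p \<longlonglongrightarrow> 1"
  proof -
    have u_F1: "(\<lambda>n. u (Suc n) / real (F (Suc n))) \<longlonglongrightarrow> 1"
      using u_F by (rule LIMSEQ_Suc)
    have u_F2: "(\<lambda>n. u (Suc (Suc n)) / real (F (Suc (Suc n)))) \<longlonglongrightarrow> 1"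
      using u_F1 by (rule LIMSEQ_Suc)
    have F_pos: "\<forall>\<^sub>F n in sequentially. real (F n) > 0"
      using F_real unfolding filterlim_at_top_dense by blast
    \<comment> \<open>\<open>p n\<close> is the quotient in \<open>ratio\<close> times correction
      factors \<open>u / F\<close>, all tending to 1.\<close>
    have "(\<lambda>n. (u n / real (F n)) * (u (Suc (Suc n)) / real (F (Suc (Suc n))))
        / (u (Suc n) / real (F (Suc n))) ^ 2
        * (real (F n) * real (F (Suc (Suc n))) / real (F (Suc n)) ^ 2)) \<longlonglongrightarrow> 1 * 1 / 1 ^ 2 * 1"
      by (intro tendsto_intros u_F u_F1 u_F2 ratio) auto
    moreover have "\<forall>\<^sub>F n in sequentially. (u n / real (F n)) * (u (Suc (Suc n)) / real (F (Suc (Suc n))))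
        / (u (Suc n) / real (F (Suc n))) ^ 2
        * (real (F n) * real (F (Suc (Suc n))) / real (F (Suc n)) ^ 2) = p n"
      using F_pos eventually_sequentially_Suc[THEN iffD2, OF F_pos]
        eventually_sequentially_Suc[THEN iffD2, OF eventually_sequentially_Suc[THEN iffD2, OF F_pos]]
      by eventually_elim (simp add: p_def field_simps power2_eq_square)
    ultimately show ?thesis
      by (simp add: tendsto_cong)
  qed
  moreover have "\<exists>N B::nat. 0 < B \<and> B \<le> Q ^ 2 \<and> (p n = real N / real B \<or> inverse (p n) = real N / real B)" for n
  proof -
    \<comment> \<open>The factors \<open>1 / Q\<close> cancel, leaving a power of \<open>b\<close>
      times \<open>C / D\<close>. The sign of \<open>i - j\<close> decides whether
      \<open>p n\<close> or its inverse has denominator at most \<open>Q ^ 2\<close>.\<close>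
    define i j where "i = l n + l (Suc (Suc n))" and "j = 2 * l (Suc n)"
    define C D where "C = A n * A (Suc (Suc n))" and "D = A (Suc n) ^ 2"
    have p: "p n = (real b ^ i * real C) / (real b ^ j * real D)"
      using Q(1)
      by (simp add: p_def u_def Y_eq i_def j_def C_def D_def power_add power_mult_distrib
          power_divide power2_eq_square mult_2 field_simps)
    have CD: "0 < C" "C \<le> Q ^ 2" "0 < D" "D \<le> Q ^ 2"
      using A_pos A_le by (auto simp: C_def D_def power2_eq_square intro: mult_mono)
    show ?thesis
    proof (cases "i \<ge> j")
      case True
      then have "real b ^ i = real b ^ j * real b ^ (i - j)"
        by (simp flip: power_add)
      then have "p n = real (b ^ (i - j) * C) / real D"
        using b by (simp add: p)
      with CD show ?thesis by blast
    next
      case False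
      then have "real b ^ j = real b ^ i * real b ^ (j - i)"
        by (simp flip: power_add)
      then have "inverse (p n) = real (b ^ (j - i) * D) / real C"
        using b by (simp add: p)
      with CD show ?thesis by blast
    qed
  qed
  ultimately have "\<forall>\<^sub>F n in sequentially. p n = 1"
    by (rule eventually_eq_1_of_bounded_denominator)
  then obtain n0 where n0: "p n = 1" if "n \<ge> n0" for n
    by (auto simp: eventually_at_top_linorder)

  \<comment> \<open>\<open>p n = 1\<close> says that consecutive quotients of \<open>u\<close>
    agree, so the first one persists from \<open>n0\<close> on.\<close>
  define c where "c = u (Suc n0) / u n0"
  have step: "u (Suc n) = c * u n" if "n \<ge> n0" for n
    using that
  proof (induction n rule: dec_induct)
    case base
    then show ?case
      using u_pos[of n0] by (simp add: c_def)
  next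
    case (step n)
    have "u n * u (Suc (Suc n)) = u (Suc n) * u (Suc n)"
      using n0[of n] step.hyps u_pos[of "Suc n"] by (simp add: p_def power2_eq_square)
    also have "\<dots> = u n * (c * u (Suc n))"
      using step.IH by simp
    finally show ?case
      using u_pos[of n] by simp
  qed
  have geom: "u (n + i) = c ^ i * u n" if "n \<ge> n0" for n i
    using that by (induction i) (auto simp: step)

  \<comment> \<open>Some numerator recurs infinitely often, so a recurrence \<open>m\<close> can be
    taken late enough that \<open>u m > u n\<close>. As \<open>Y m = Y n\<close>, this forces
    \<open>l m > l n\<close>, and the subtraction in \<open>t\<close> is not truncated.\<close>
  have "A ` {n0..} \<subseteq> {..Q}"
    using A_le by blast
  then have "finite (A ` {n0..})"
    by (rule finite_subset) simp
  from pigeonhole_infinite[OF infinite_Ici this]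
  obtain n where n: "n \<ge> n0" "infinite {m \<in> {n0..}. A m = A n}"
    by blast
  have "\<forall>\<^sub>F m in sequentially. real (F m) > u n"
    using F_real unfolding filterlim_at_top_dense by blast
  then obtain m0 where m0: "real (F m) > u n" if "m \<ge> m0" for m
    by (auto simp: eventually_at_top_linorder)
  have "\<exists>m\<in>{m \<in> {n0..}. A m = A n}. \<not> m \<le> max m0 n"
    using n(2) unfolding finite_nat_set_iff_bounded_le by blast
  then obtain m where m: "m > max m0 n" "A m = A n"
    by (auto simp: not_le)
  have Y_m: "Y m = Y n"
    using m by (simp add: Y_eq)
  define s t where "s = m - n" and "t = l m - l n"
  have "u m > u n"
    using m0[of m] m u_ge[of m] by auto
  then have "real b ^ l m > real b ^ l n"
    using Y(1)[of n] by (simp add: u_def Y_m)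
  then have "l m > l n"
    using b by simp
  have "u m = c ^ s * u n"
    using geom[OF n(1), of s] m by (simp add: s_def)
  then have "real b ^ l m = c ^ s * real b ^ l n"
    using Y(1)[of n] by (simp add: u_def Y_m)
  then have cs: "c ^ s = real b ^ t"
    using b \<open>l m > l n\<close> by (simp add: t_def power_diff field_simps)

  \<comment> \<open>\<open>c = x / y\<close> is rational and \<open>c ^ s\<close> is an integer, so
    \<open>y ^ s\<close> divides \<open>x ^ s\<close>; hence \<open>y\<close> divides
    \<open>x\<close> and \<open>c\<close> is a natural number.\<close>
  define x y where "x = b ^ l (Suc n0) * A (Suc n0)" and "y = b ^ l n0 * A n0"
  have "y > 0"
    using b A_pos by (simp add: y_def)
  have c: "c = real x / real y"
    using Q(1) by (simp add: c_def u_def x_def y_def Y_eq)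
  then have "real x = c * real y"
    using \<open>y > 0\<close> by simp
  then have "real (x ^ s) = real (b ^ t * y ^ s)"
    using cs by (simp add: power_mult_distrib)
  then have "x ^ s = b ^ t * y ^ s"
    by (simp only: of_nat_eq_iff)
  moreover have "s > 0"
    using m by (simp add: s_def)
  ultimately have "y dvd x"
    using pow_divides_pow_iff[of s y x] by simp
  then obtain z where "x = y * z" ..
  then have z: "c = real z"
    using c \<open>y > 0\<close> by simp
  then have "real (z ^ s) = real (b ^ t)"
    using cs by simp
  then have "z ^ s = b ^ t"
    by (simp only: of_nat_eq_iff)
  then obtain k where "z = b ^ k"
    using \<open>s > 0\<close> b by (rule power_eq_power_not_proper_power)
  then have "\<forall>n\<ge>n0. u (Suc n) = real b ^ k * u n"
    using step z by simp
  then show ?thesis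
    using that[of k] unfolding u_def by (auto simp: eventually_at_top_linorder)
qed

text \<open>The finitely many values have a maximum, and once it is attained monotonicity keeps
  it.\<close>

lemma mono_on_bounded_eventually_const:
  fixes f :: "nat \<Rightarrow> nat"
  assumes "mono_on {a..} f" "\<And>n. n \<ge> a \<Longrightarrow> f n \<le> M"
  obtains v where "\<forall>\<^sub>F n in sequentially. f n = v"
proof -
  have "f ` {a..} \<subseteq> {..M}"
    using assms(2) by auto
  then have fin: "finite (f ` {a..})"
    by (rule finite_subset) simp
  then have "Max (f ` {a..}) \<in> f ` {a..}"
    by (intro Max_in) auto
  then obtain n0 where n0: "n0 \<ge> a" "f n0 = Max (f ` {a..})"
    by auto
  have "f n = f n0" if "n \<ge> n0" for n
  proof (rule antisym)
    show "f n \<le> f n0"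
      using n0 that fin by (simp add: Max_ge)
    show "f n0 \<le> f n"
      using n0(1) that by (intro mono_onD[OF assms(1)]) auto
  qed
  then show ?thesis
    by (intro that[of "f n0"] eventually_sequentiallyI)
qed

section \<open>Bounded and unbounded \<open>f\<close>, and the limit of \<open>g\<close>\<close>

theorem theorem2:
  fixes b :: nat and f :: "nat \<Rightarrow> nat" and g :: "nat \<Rightarrow> real"
  assumes "b \<ge> 2" and "\<not> proper_power (int b)"
    and "continuous_on {1..} g" and "mono_on {1..} g"
    and "(\<lambda>n. g (n + 1) / g n) \<longlonglongrightarrow> 1"
    and "\<And>n. n \<ge> 1 \<Longrightarrow> f n \<ge> 1" and "mono_on {1..} f"
    and "(\<lambda>n. real (f (n + 1)) / real (f n)) \<sim>[at_top] g"
    and "concat_real b f \<in> \<rat>"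
  shows "\<exists>c. g \<longlonglongrightarrow> c \<and> (\<exists>k::nat. c = real b ^ k) \<and>
           (\<lambda>n. real (f (n + 1)) - c * real (f n)) \<in> O(\<lambda>_. 1)"
proof (cases "\<exists>M. \<forall>n\<ge>1. f n \<le> M")
  \<comment> \<open>An eventually constant \<open>f\<close> has ratio 1, so here
    \<open>c = 1 = b ^ 0\<close> and the difference is eventually 0.\<close>
  case True
  then obtain v where v: "\<forall>\<^sub>F n in sequentially. f n = v"
    using mono_on_bounded_eventually_const[OF assms(7)] by blast
  then have v': "\<forall>\<^sub>F n in sequentially. f (n + 1) = v"
    unfolding Suc_eq_plus1[symmetric] by (rule eventually_sequentially_Suc[THEN iffD2])
  have "\<forall>\<^sub>F n in sequentially. real (f (n + 1)) / real (f n) = 1"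
    using v v' eventually_ge_at_top[of 1]
  proof eventually_elim
    case (elim n)
    then show ?case
      using assms(6)[of n] by simp
  qed
  then have "(\<lambda>n. real (f (n + 1)) / real (f n)) \<longlonglongrightarrow> 1"
    by (rule tendsto_eventually)
  then have "g \<longlonglongrightarrow> 1"
    using tendsto_asymp_equiv_cong[OF assms(8)] by blast
  moreover have "(\<lambda>n. real (f (n + 1)) - 1 * real (f n)) \<in> O(\<lambda>_. 1)"
    by (rule bigoI[of _ 0]) (use v v' in eventually_elim, simp)
  ultimately show ?thesis
    by (intro exI[of _ 1] conjI exI[of _ "0::nat"]) auto
next
  case False
  \<comment> \<open>The indices are shifted so that \<open>Y 0\<close> is the given number and
    \<open>F n\<close> is the leading block of \<open>Y n\<close>.\<close>
  define F where "F n = f (Suc n)" for n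
  define l where "l n = length (base_repr b (F n))" for n
  define Y where "Y n = concat_real b (\<lambda>m. f (m + n))" for n
  have rec: "real b ^ l n * Y n = real (F n) + Y (Suc n)" for n
    using concat_real_unfold[OF assms(1), of "\<lambda>m. f (m + n)"]
    by (simp add: l_def Y_def F_def)
  have F_ge: "F n \<ge> 1" for n
    using assms(6) by (simp add: F_def)
  have Y_le: "Y n \<le> 1" and Y_ge: "Y n \<ge> 0" for n
    using concat_real_bounds[OF assms(1)] by (simp_all add: Y_def)
  have Y_pos: "Y n > 0" for n
  proof -
    have "real b ^ l n * Y n > 0"
      using rec[of n] F_ge[of n] Y_ge[of "Suc n"] by linarith
    then show ?thesis
      using assms(1) by (simp add: zero_less_mult_iff)
  qed

  obtain q r :: int where "r > 0" and q: "concat_real b f = real_of_int q / real_of_int r"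
    using assms(9) by (auto elim!: Rats_cases')
  \<comment> \<open>A denominator of \<open>Y 0\<close> serves for every \<open>Y n\<close>, since
    \<open>rec\<close> writes \<open>Q * Y (Suc n)\<close> as an integer combination of
    \<open>Q * Y n\<close> and \<open>Q\<close>.\<close>
  define Q where "Q = nat r"
  have Q: "Q > 0" "real Q = real_of_int r"
    using \<open>r > 0\<close> by (simp_all add: Q_def)
  have Q_Ints: "real Q * Y n \<in> \<int>" for n
  proof (induction n)
    case 0
    then show ?case
      using Q \<open>r > 0\<close> q by (simp add: Y_def)
  next
    case (Suc n)
    have "real Q * Y (Suc n) = real b ^ l n * (real Q * Y n) - real Q * real (F n)"
      using rec[of n] by (simp add: algebra_simps flip: distrib_left)
    also have "\<dots> \<in> \<int>"
      using Suc by (intro Ints_diff Ints_mult[OF _ Suc] Ints_mult) auto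
    finally show ?case .
  qed

  have F_mono: "F m \<le> F n" if "m \<le> n" for m n
    using that assms(7) by (auto simp: F_def intro: mono_onD)
  have F_lim: "filterlim F at_top at_top"
    unfolding filterlim_at_top
  proof
    fix M
    obtain n where "n \<ge> 1" "f n > M"
      using False by (meson not_le)
    then have "F (n - 1) \<ge> M"
      by (simp add: F_def)
    then have "\<forall>m\<ge>n - 1. M \<le> F m"
      using F_mono order_trans by blast
    then show "\<forall>\<^sub>F n in sequentially. M \<le> F n"
      by (auto simp: eventually_at_top_linorder)
  qed
  have F_real: "filterlim (\<lambda>n. real (F n)) at_top at_top"
    by (rule filterlim_compose[OF filterlim_real_sequentially F_lim])

  \<comment> \<open>Two consecutive ratios of \<open>F\<close> are asymptotic to consecutive values
    of \<open>g\<close>, whose quotient tends to 1; this eliminates \<open>g\<close> and yields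
    \<open>ratio\<close>.\<close>
  have asymp1: "(\<lambda>n. real (F (Suc n)) / real (F n)) \<sim>[at_top] (\<lambda>n. g (Suc n))"
    using asymp_equiv_compose'[OF assms(8) filterlim_Suc] by (simp add: F_def)
  have asymp2: "(\<lambda>n. real (F (Suc (Suc n))) / real (F (Suc n))) \<sim>[at_top] (\<lambda>n. g (Suc (Suc n)))"
    using asymp_equiv_compose'[OF asymp1 filterlim_Suc] .
  have "(\<lambda>n. g (Suc (Suc n))) \<sim>[at_top] (\<lambda>n. g (Suc n))"
    using LIMSEQ_Suc[OF assms(5)] by (intro asymp_equivI') simp
  then have "(\<lambda>n. real (F (Suc (Suc n))) / real (F (Suc n))) \<sim>[at_top] (\<lambda>n. real (F (Suc n)) / real (F n))"
    using asymp1 asymp2 by (metis asymp_equiv_sym asymp_equiv_trans)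
  then have "(\<lambda>n. (real (F (Suc (Suc n))) / real (F (Suc n))) / (real (F (Suc n)) / real (F n))) \<longlonglongrightarrow> 1"
    using F_ge by (intro asymp_equivD_strong always_eventually) (auto simp: Suc_le_eq dest: gr_implies_not0)
  then have ratio: "(\<lambda>n. real (F n) * real (F (Suc (Suc n))) / real (F (Suc n)) ^ 2) \<longlonglongrightarrow> 1"
    by (simp add: field_simps power2_eq_square)

  obtain k where k: "\<forall>\<^sub>F n in sequentially.
      real b ^ l (Suc n) * Y (Suc n) = real b ^ k * (real b ^ l n * Y n)"
    using eventually_geometric[OF assms(1,2) rec Y_pos Y_le Q(1) Q_Ints F_lim ratio] by blast
  define c where "c = real b ^ k"
  \<comment> \<open>Rewriting both sides of \<open>k\<close> by \<open>rec\<close> leaves only the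
    tails \<open>Y\<close>, which lie in the unit interval.\<close>
  have diff: "\<forall>\<^sub>F n in sequentially. real (F (Suc n)) - c * real (F n) = c * Y (Suc n) - Y (Suc (Suc n))"
    using k unfolding rec c_def by eventually_elim (simp add: algebra_simps)
  have c: "c \<ge> 0"
    by (simp add: c_def)
  have bound: "\<bar>c * Y (Suc n) - Y (Suc (Suc n))\<bar> \<le> c + 1" for n
  proof -
    have "0 \<le> c * Y (Suc n)" "c * Y (Suc n) \<le> c"
      using c Y_ge Y_le by (auto simp: mult_left_le)
    then show ?thesis
      using Y_ge[of "Suc (Suc n)"] Y_le[of "Suc (Suc n)"] by linarith
  qed
  have diff_bound: "\<forall>\<^sub>F n in sequentially. \<bar>real (F (Suc n)) - c * real (F n)\<bar> \<le> c + 1"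
    using diff by eventually_elim (simp add: bound)
  then have "\<forall>\<^sub>F n in sequentially. \<bar>real (f (Suc n)) - c * real (f n)\<bar> \<le> c + 1"
    unfolding F_def by (rule eventually_sequentially_Suc[THEN iffD1])
  then have O: "(\<lambda>n. real (f (n + 1)) - c * real (f n)) \<in> O(\<lambda>_. 1)"
    by (intro bigoI[of _ "c + 1"]) simp

  \<comment> \<open>The bounded difference is divided by \<open>F n\<close>, which tends to
    infinity; the limit then passes to \<open>g\<close> by \<open>asymp1\<close>.\<close>
  have "(\<lambda>n. real (F (Suc n)) / real (F n) - c) \<longlonglongrightarrow> 0"
  proof (rule tendsto_0_le[OF tendsto_inverse_0_at_top[OF F_real], where K = "c + 1"])
    show "\<forall>\<^sub>F n in sequentially.
        norm (real (F (Suc n)) / real (F n) - c) \<le> norm (inverse (real (F n))) * (c + 1)"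
      using diff_bound
    proof eventually_elim
      case (elim n)
      have pos: "real (F n) > 0"
        using F_ge[of n] by simp
      then have "real (F (Suc n)) / real (F n) - c = (real (F (Suc n)) - c * real (F n)) / real (F n)"
        by (simp add: field_simps)
      then show ?case
        using elim pos by (simp add: abs_divide field_simps divide_right_mono)
    qed
  qed
  then have "(\<lambda>n. real (F (Suc n)) / real (F n)) \<longlonglongrightarrow> c"
    by (rule LIM_zero_cancel)
  then have "(\<lambda>n. g (Suc n)) \<longlonglongrightarrow> c"
    using tendsto_asymp_equiv_cong[OF asymp1] by blast
  then have "g \<longlonglongrightarrow> c"
    by (rule LIMSEQ_imp_Suc)
  with O c_def show ?thesis
    by blast
qed

end
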